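(* Let $V$ and $H$ be complex Hilbert spaces, let $\mathfrak{a} \colon V \times V \to \mathbb{C}$ be a symmetric continuous sesquilinear form which is compactly elliptic, and let $j \in \mathcal{L}(V,H)$. Let $A$ be the graph associated with $(\mathfrak{a},j)$ (which is a self-adjoint graph). Let $H_1 = \overline{j(V(\mathfrak{a}))}$, where the closure is in $H$. Then $A \cap (H_1 \times H_1)$ is the graph of the single-valued part of $A$.
   Context: Sesquilinear forms are linear in the first and antilinear in the second variable, and $\mathfrak{a}(u) := \mathfrak{a}(u,u)$. $\mathcal{L}(X,Y)$ denotes the bounded linear operators from $X$ to $Y$. The form $\mathfrak{a}$ is called compactly elliptic if there exist a Hilbert space $\widetilde{H}$, a compact $\tilde{j} \in \mathcal{L}(V,\widetilde{H})$, $\omega \in \mathbb{R}$ and $\mu > 0$ such that $\mathrm{Re}\, \mathfrak{a}(u) + \omega \|\tilde{j}(u)\|_{\widetilde{H}}^2 \geq \mu \|u\|_V^2$ for all $u \in V$. $V(\mathfrak{a}) := \{u \in V : \mathfrak{a}(u,v) = 0 \text{ for all } v \in \ker j\}$. A graph in $H$ is a linear subspace of $H \times H$. The graph associated with $(\mathfrak{a},j)$ is $$A = \{(x,y) \in H \times H : \text{there exists } u \in V \text{ such that } j(u) = x \text{ and } \mathfrak{a}(u,v) = (y,j(v))_H \text{ for all } v \in V\}.$$ A graph $A$ is self-adjoint if $(x,y)_H \in \mathbb{R}$ for all $(x,y) \in A$ and, for all $s \in \mathbb{R} \setminus \{0\}$, the graph $A + isI = \{(x,y+isx) : (x,y) \in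 A\}$ is surjective. For a self-adjoint graph $A$ put $A(0) = \{y \in H : (0,y) \in A\}$ and $D(A) = \{x \in H : (x,y) \in A \text{ for some } y \in H\}$; then $D(A) \subset A(0)^\perp$. The single-valued part of $A$ is the operator $A^\circ$ in the Hilbert space $A(0)^\perp$ with domain $D(A^\circ) = D(A)$ and $A^\circ x = y$, where $y \in A(0)^\perp$ is the unique element of $A(0)^\perp$ such that $(x,y) \in A$. *)

theory Defs
  imports "HOL-Analysis.Analysis"
begin

(* The scalar product is linear in the FIRST argument. Its real part is the library's real
   inner product, so norm, topology, closure, continuity and completeness of a complex Hilbert
   space are those of the library; positive definiteness of cinner is inherited from real_inner. *)
class complex_inner = real_inner +
  fixes scaleC :: "complex \<Rightarrow> 'a \<Rightarrow> 'a" (infixr "*\<^sub>C" 75)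
    and cinner :: "'a \<Rightarrow> 'a \<Rightarrow> complex"
  assumes scaleC_add_right: "c *\<^sub>C (x + y) = c *\<^sub>C x + c *\<^sub>C y"
    and scaleC_add_left: "(c + d) *\<^sub>C x = c *\<^sub>C x + d *\<^sub>C x"
    and scaleC_scaleC: "c *\<^sub>C d *\<^sub>C x = (c * d) *\<^sub>C x"
    and scaleR_scaleC: "r *\<^sub>R x = complex_of_real r *\<^sub>C x"
    and cinner_add_left: "cinner (x + y) z = cinner x z + cinner y z"
    and cinner_scaleC_left: "cinner (c *\<^sub>C x) y = c * cinner x y"
    and cinner_commute: "cinner x y = cnj (cinner y x)"
    and inner_Re_cinner: "inner x y = Re (cinner x y)"

class complex_hilbert = complex_inner + complete_space

definition bounded_clinear :: "('a::complex_inner \<Rightarrow> 'b::complex_inner) \<Rightarrow> bool" where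
  "bounded_clinear f \<longleftrightarrow> bounded_linear f \<and> (\<forall>c x. f (c *\<^sub>C x) = c *\<^sub>C f x)"

definition compact_operator :: "('a::complex_inner \<Rightarrow> 'b::complex_inner) \<Rightarrow> bool" where
  "compact_operator f \<longleftrightarrow> bounded_clinear f \<and> compact (closure (f ` cball 0 1))"

definition sesquilinear :: "('v::complex_inner \<Rightarrow> 'v \<Rightarrow> complex) \<Rightarrow> bool" where
  "sesquilinear a \<longleftrightarrow>
     (\<forall>u u' v. a (u + u') v = a u v + a u' v) \<and>
     (\<forall>c u v. a (c *\<^sub>C u) v = c * a u v) \<and>
     (\<forall>u v v'. a u (v + v') = a u v + a u v') \<and>
     (\<forall>c u v. a u (c *\<^sub>C v) = cnj c * a u v)"

definition continuous_form :: "('v::complex_inner \<Rightarrow> 'v \<Rightarrow> complex) \<Rightarrow> bool" where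
  "continuous_form a \<longleftrightarrow> continuous_on UNIV (\<lambda>(u, v). a u v)"

definition symmetric_form :: "('v::complex_inner \<Rightarrow> 'v \<Rightarrow> complex) \<Rightarrow> bool" where
  "symmetric_form a \<longleftrightarrow> (\<forall>u v. a u v = cnj (a v u))"

(* The auxiliary Hilbert space is passed as a type argument, since HOL has no existential
   quantifier over types. As a hypothesis, with 'w a type variable not occurring in the
   conclusion, this amounts to the existence of some auxiliary Hilbert space. *)
definition compactly_elliptic ::
    "'w::complex_hilbert itself \<Rightarrow> ('v::complex_hilbert \<Rightarrow> 'v \<Rightarrow> complex) \<Rightarrow> bool" where
  "compactly_elliptic (_ :: 'w itself) a \<longleftrightarrow>
     (\<exists>(jt :: 'v \<Rightarrow> 'w) (\<omega> :: real) (\<mu> :: real). compact_operator jt \<and> \<mu> > 0 \<and>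
        (\<forall>u. Re (a u u) + \<omega> * (norm (jt u))\<^sup>2 \<ge> \<mu> * (norm u)\<^sup>2))"

(* V(a), which depends on j as well *)
definition form_subspace ::
    "('v::complex_inner \<Rightarrow> 'v \<Rightarrow> complex) \<Rightarrow> ('v \<Rightarrow> 'h::complex_inner) \<Rightarrow> 'v set" where
  "form_subspace a j = {u. \<forall>v. j v = 0 \<longrightarrow> a u v = 0}"

definition linear_graph :: "('h::complex_inner \<times> 'h) set \<Rightarrow> bool" where
  "linear_graph A \<longleftrightarrow> (0, 0) \<in> A \<and>
     (\<forall>x y x' y'. (x, y) \<in> A \<longrightarrow> (x', y') \<in> A \<longrightarrow> (x + x', y + y') \<in> A) \<and>
     (\<forall>c x y. (x, y) \<in> A \<longrightarrow> (c *\<^sub>C x, c *\<^sub>C y) \<in> A)"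

definition associated_graph ::
    "('v::complex_inner \<Rightarrow> 'v \<Rightarrow> complex) \<Rightarrow> ('v \<Rightarrow> 'h::complex_inner) \<Rightarrow> ('h \<times> 'h) set" where
  "associated_graph a j = {(x, y). \<exists>u. j u = x \<and> (\<forall>v. a u v = cinner y (j v))}"

definition graph_shift :: "('h::complex_inner \<times> 'h) set \<Rightarrow> complex \<Rightarrow> ('h \<times> 'h) set" where
  "graph_shift A c = {(x, y + c *\<^sub>C x) |x y. (x, y) \<in> A}"

definition self_adjoint_graph :: "('h::complex_inner \<times> 'h) set \<Rightarrow> bool" where
  "self_adjoint_graph A \<longleftrightarrow> linear_graph A \<and>
     (\<forall>(x, y) \<in> A. cinner x y \<in> \<real>) \<and>
     (\<forall>s::real. s \<noteq> 0 \<longrightarrow> Range (graph_shift A (\<i> * complex_of_real s)) = UNIV)"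

definition orthogonal_complement :: "'h::complex_inner set \<Rightarrow> 'h set" where
  "orthogonal_complement S = {x. \<forall>y\<in>S. cinner x y = 0}"

(* A(0) is the relational image A `` {0}. The operator is a partial function on H whose domain
   is D(A) and whose values lie in the orthogonal complement of A(0). The definite description
   is meaningful for self-adjoint graphs A. *)
definition single_valued_part :: "('h::complex_inner \<times> 'h) set \<Rightarrow> ('h \<rightharpoonup> 'h)" where
  "single_valued_part A = (\<lambda>x. if x \<in> Domain A
     then Some (THE y. y \<in> orthogonal_complement (A `` {0}) \<and> (x, y) \<in> A) else None)"

end

theory Submission
  imports Defs
begin

text \<open>The statement separates into a fact about arbitrary self-adjoint graphs and an identification of
  \<open>H\<^sub>1\<close>.

  For every self-adjoint graph \<open>A\<close> one has \<open>A(0) = D(A)\<^sup>\<bottom>\<close> (\<open>self_adjoint_graph_image_0\<close>), so \<open>A(0)\<close> is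
  closed, \<open>A(0)\<^sup>\<bottom>\<close> is the closure of \<open>D(A)\<close>, and projecting values onto \<open>A(0)\<^sup>\<bottom>\<close> shows that the graph
  of the single-valued part is \<open>A \<inter> (H \<times> A(0)\<^sup>\<bottom>)\<close> (\<open>graph_single_valued_part\<close>). For the graph associated
  with \<open>(a, j)\<close>, an element witnessing \<open>x \<in> D(A)\<close> lies in \<open>V(a)\<close>, and symmetry of the form makes
  \<open>j(V(a))\<close> orthogonal to \<open>A(0)\<close>. Hence \<open>D(A) \<subseteq> j(V(a)) \<subseteq> A(0)\<^sup>\<bottom>\<close>, and since the outer two sets have the
  same closure, \<open>H\<^sub>1 = A(0)\<^sup>\<bottom>\<close>.

  The analytic content is the self-adjointness of the associated graph, more precisely the
  surjectivity of \<open>A + \<i> s I\<close>. It is a Fredholm argument for the form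
  \<open>b(u, v) = a(u, v) + \<i> s (j u, j v)\<close>: compact ellipticity makes the operator of \<open>b\<close> bounded below on
  the orthogonal complement of its kernel (\<open>elliptic_bounded_below\<close>), so its range is closed and
  \<open>b(u, \<cdot>) = \<phi>\<close> is solvable as soon as \<open>\<phi>\<close> vanishes on all \<open>q\<close> with \<open>b(\<cdot>, q) = 0\<close>
  (\<open>elliptic_form_solvable\<close>). Such \<open>q\<close> lie in \<open>ker j\<close>, on which \<open>\<phi> = (f, j \<cdot>)\<close> vanishes.\<close>

section \<open>Complex inner product spaces\<close>

lemma cinner_add_right: "cinner x (y + z) = cinner x y + cinner x z"
  by (metis cinner_add_left cinner_commute complex_cnj_add)

lemma cinner_scaleC_right: "cinner x (c *\<^sub>C y) = cnj c * cinner x y"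
  by (metis cinner_scaleC_left cinner_commute complex_cnj_mult)

lemma cinner_scaleR_left: "cinner (r *\<^sub>R x) y = r *\<^sub>R cinner x y"
  by (simp add: scaleR_scaleC cinner_scaleC_left scaleR_conv_of_real)

lemma cinner_scaleR_right: "cinner x (r *\<^sub>R y) = r *\<^sub>R cinner x y"
  by (simp add: scaleR_scaleC cinner_scaleC_right scaleR_conv_of_real)

lemma cinner_self: "cinner x x = complex_of_real ((norm x)\<^sup>2)"
proof (rule complex_eqI)
  show "Re (cinner x x) = Re (complex_of_real ((norm x)\<^sup>2))"
    by (simp add: inner_Re_cinner[symmetric] power2_norm_eq_inner)
  have "Im (cinner x x) = - Im (cinner x x)"
    using arg_cong[OF cinner_commute[of x x], of Im] by simp
  then show "Im (cinner x x) = Im (complex_of_real ((norm x)\<^sup>2))" by simp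
qed

lemma norm_scaleC: "norm (c *\<^sub>C x) = cmod c * norm (x::'a::complex_inner)"
proof -
  have "complex_of_real ((norm (c *\<^sub>C x))\<^sup>2) = c * cnj c * complex_of_real ((norm x)\<^sup>2)"
    unfolding cinner_self[symmetric] by (simp add: cinner_scaleC_left cinner_scaleC_right)
  also have "\<dots> = complex_of_real ((cmod c * norm x)\<^sup>2)"
    by (simp add: complex_norm_square[symmetric] power_mult_distrib)
  finally have "(norm (c *\<^sub>C x))\<^sup>2 = (cmod c * norm x)\<^sup>2"
    using of_real_eq_iff by blast
  then show ?thesis by (simp add: power2_eq_iff_nonneg)
qed

text \<open>Multiplying the first argument by a phase makes the scalar product real and nonnegative, which
  reduces the claim to the real Cauchy--Schwarz inequality.\<close>

lemma norm_cinner_le: "cmod (cinner x y) \<le> norm x * norm (y::'a::complex_inner)"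
proof (cases "cinner x y = 0")
  case False
  define c where "c = cnj (cinner x y) / cmod (cinner x y)"
  have c: "cmod c = 1" using False by (simp add: c_def norm_divide)
  have "c * cinner x y = complex_of_real (cmod (cinner x y))"
    using False by (simp add: c_def complex_norm_square[symmetric] power2_eq_square mult.commute
        [of "cnj _"])
  then have "cmod (cinner x y) = inner (c *\<^sub>C x) y"
    by (simp add: inner_Re_cinner cinner_scaleC_left)
  also have "\<dots> \<le> norm (c *\<^sub>C x) * norm y" by (rule norm_cauchy_schwarz)
  finally show ?thesis by (simp add: norm_scaleC c)
qed simp

text \<open>Over the reals, the scalar product is a bounded bilinear map; this makes its continuity
  and its behaviour under zero and differences available.\<close>

lemma bounded_bilinear_cinner: "bounded_bilinear (cinner :: 'a::complex_inner \<Rightarrow> 'a \<Rightarrow> complex)"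
proof
  show "\<exists>K. \<forall>a b::'a. norm (cinner a b) \<le> norm a * norm b * K"
    by (rule exI[of _ 1]) (simp add: norm_cinner_le)
qed (simp_all add: cinner_add_left cinner_add_right cinner_scaleR_left cinner_scaleR_right)

lemmas cinner_zero_left = bounded_bilinear.zero_left[OF bounded_bilinear_cinner]
  and cinner_zero_right = bounded_bilinear.zero_right[OF bounded_bilinear_cinner]
  and cinner_diff_left = bounded_bilinear.diff_left[OF bounded_bilinear_cinner]
  and cinner_diff_right = bounded_bilinear.diff_right[OF bounded_bilinear_cinner]
  and tendsto_cinner = bounded_bilinear.tendsto[OF bounded_bilinear_cinner]
  and continuous_on_cinner = bounded_bilinear.continuous_on[OF bounded_bilinear_cinner]

lemma cinner_self_eq_0: "cinner x x = 0 \<longleftrightarrow> x = 0"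
  by (simp add: cinner_self)

lemma scaleC_minus_one: "(- 1) *\<^sub>C x = - (x::'a::complex_inner)"
  using scaleR_scaleC[of "-1" x] by simp

lemma tendsto_scaleC:
  assumes "(f \<longlongrightarrow> (x::'a::complex_inner)) F"
  shows "((\<lambda>n. c *\<^sub>C f n) \<longlongrightarrow> c *\<^sub>C x) F"
proof -
  have "bounded_linear (\<lambda>x::'a. c *\<^sub>C x)"
    by (rule bounded_linear_intro[of _ "cmod c"])
      (simp_all add: scaleC_add_right scaleR_scaleC scaleC_scaleC norm_scaleC mult.commute)
  then show ?thesis using assms by (rule bounded_linear.tendsto)
qed

section \<open>Orthogonal projection and the Riesz representation theorem\<close>

definition csubspace :: "'a::complex_inner set \<Rightarrow> bool" where
  "csubspace S \<longleftrightarrow> 0 \<in> S \<and> (\<forall>x\<in>S. \<forall>y\<in>S. x + y \<in> S) \<and> (\<forall>c. \<forall>x\<in>S. c *\<^sub>C x \<in> S)"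

lemma csubspace_diff: "csubspace S \<Longrightarrow> x \<in> S \<Longrightarrow> y \<in> S \<Longrightarrow> x - y \<in> S"
  unfolding csubspace_def by (metis scaleC_minus_one uminus_add_conv_diff add.commute)

lemma csubspace_scaleR: "csubspace S \<Longrightarrow> x \<in> S \<Longrightarrow> r *\<^sub>R x \<in> S"
  unfolding csubspace_def by (metis scaleR_scaleC)

lemma csubspace_closure:
  assumes "csubspace S" shows "csubspace (closure S)"
  unfolding csubspace_def
proof (intro conjI ballI allI)
  show "0 \<in> closure S" using assms closure_subset unfolding csubspace_def by blast
next
  fix x y assume "x \<in> closure S" "y \<in> closure S"
  then obtain f g where "\<And>n. f n \<in> S" "f \<longlonglongrightarrow> x" "\<And>n. g n \<in> S" "g \<longlonglongrightarrow> y"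
    by (auto simp: closure_sequential)
  then show "x + y \<in> closure S"
    using assms unfolding closure_sequential csubspace_def
    by (intro exI[of _ "\<lambda>n. f n + g n"]) (auto intro: tendsto_add)
next
  fix c x assume "x \<in> closure S"
  then obtain f where "\<And>n. f n \<in> S" "f \<longlonglongrightarrow> x"
    by (auto simp: closure_sequential)
  then show "c *\<^sub>C x \<in> closure S"
    using assms unfolding closure_sequential csubspace_def
    by (intro exI[of _ "\<lambda>n. c *\<^sub>C f n"]) (auto intro: tendsto_scaleC)
qed

lemma closed_orthogonal_complement: "closed (orthogonal_complement (S::'a::complex_inner set))"
proof -
  have "orthogonal_complement S = (\<Inter>y\<in>S. {x. cinner x y = 0})"
    by (auto simp: orthogonal_complement_def)
  also have "closed \<dots>"
    by (intro closed_INT ballI closed_Collect_eq continuous_on_cinner continuous_intros)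
  finally show ?thesis .
qed

lemma csubspace_orthogonal_complement: "csubspace (orthogonal_complement S)"
  by (auto simp: csubspace_def orthogonal_complement_def cinner_add_left cinner_scaleC_left
      cinner_zero_left)

text \<open>By the parallelogram law every minimising sequence for the distance from \<open>x\<close> to \<open>S\<close> is
  Cauchy, so the minimum is attained; a minimiser is orthogonal to \<open>S\<close> because the
  quadratic polynomial \<open>t \<mapsto> \<parallel>x - p - t y\<parallel>\<^sup>2\<close> has its minimum at \<open>0\<close>.\<close>

lemma orthogonal_projection_exists:
  fixes S :: "'a::complex_hilbert set"
  assumes S: "csubspace S" and cl: "closed S"
  obtains p where "p \<in> S" "x - p \<in> orthogonal_complement S"
proof -
  define D where "D = (INF y\<in>S. (norm (x - y))\<^sup>2)"
  have ne: "S \<noteq> {}" using S by (auto simp: csubspace_def)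
  have bdd: "bdd_below ((\<lambda>y. (norm (x - y))\<^sup>2) ` S)"
    by (rule bdd_belowI2[of _ 0]) simp
  have D_le: "D \<le> (norm (x - y))\<^sup>2" if "y \<in> S" for y
    unfolding D_def by (rule cINF_lower[OF bdd that])
  have "\<exists>y\<in>S. (norm (x - y))\<^sup>2 < D + 1 / real (Suc n)" for n
  proof (rule ccontr)
    assume "\<not> ?thesis"
    then have "D + 1 / real (Suc n) \<le> D"
      unfolding D_def by (intro cINF_greatest[OF ne]) (auto simp: not_less)
    then show False by simp
  qed
  then obtain f where f: "\<And>n. f n \<in> S" "\<And>n. (norm (x - f n))\<^sup>2 < D + 1 / real (Suc n)"
    by metis
  have par: "(norm (f m - f n))\<^sup>2 \<le> 2 / real (Suc m) + 2 / real (Suc n)" for m n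
  proof -
    define z where "z = (1/2) *\<^sub>R (f m + f n)"
    have "z \<in> S" using S f(1) unfolding z_def
      by (intro csubspace_scaleR) (auto simp: csubspace_def)
    then have "D \<le> (norm (x - z))\<^sup>2" by (rule D_le)
    moreover have "(norm (f m - f n))\<^sup>2
        = 2 * (norm (x - f m))\<^sup>2 + 2 * (norm (x - f n))\<^sup>2 - 4 * (norm (x - z))\<^sup>2"
      unfolding z_def power2_norm_eq_inner
      by (simp add: inner_simps inner_commute field_simps)
    moreover have "2 / real (Suc k) = 2 * (1 / real (Suc k))" for k by simp
    ultimately show ?thesis using f(2)[of m] f(2)[of n] by linarith
  qed
  have "Cauchy f"
  proof (rule CauchyI)
    fix e :: real assume e: "e > 0"
    obtain M where M: "4 / e\<^sup>2 < real M" using reals_Archimedean2 by blast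
    have Mpos: "real M > 0" using M e by (smt (verit) divide_pos_pos zero_less_power)
    show "\<exists>M. \<forall>m\<ge>M. \<forall>n\<ge>M. norm (f m - f n) < e"
    proof (intro exI allI impI)
      fix m n assume mn: "m \<ge> M" "n \<ge> M"
      have "2 / real (Suc m) \<le> 2 / real M" "2 / real (Suc n) \<le> 2 / real M"
        using mn Mpos by (auto intro!: divide_left_mono)
      then have "(norm (f m - f n))\<^sup>2 \<le> 4 / real M" using par[of m n] by linarith
      also have "\<dots> < e\<^sup>2" using M Mpos e by (simp add: field_simps)
      finally show "norm (f m - f n) < e" using e by (simp add: power_less_imp_less_base)
    qed
  qed
  then obtain p where p: "f \<longlonglongrightarrow> p" using Cauchy_convergent_iff convergent_def by blast
  have pS: "p \<in> S" using cl f(1) p closed_sequentially by blast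
  have "(norm (x - p))\<^sup>2 \<le> D"
  proof (rule LIMSEQ_le)
    show "(\<lambda>n. (norm (x - f n))\<^sup>2) \<longlonglongrightarrow> (norm (x - p))\<^sup>2" by (intro tendsto_intros p)
    have "(\<lambda>n. D + 1 / real (Suc n)) \<longlonglongrightarrow> D + 0"
      by (intro tendsto_add tendsto_const LIMSEQ_Suc[OF lim_1_over_n])
    then show "(\<lambda>n. D + 1 / real (Suc n)) \<longlonglongrightarrow> D" by simp
  qed (use f(2) less_imp_le in blast)
  then have min: "(norm (x - p))\<^sup>2 \<le> (norm (x - y))\<^sup>2" if "y \<in> S" for y
    using D_le[OF that] by linarith
  (* t is the minimiser of the quadratic polynomial in the direction y *)
  have orth: "inner (x - p) y = 0" if y: "y \<in> S" for y
  proof (cases "y = 0")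
    case False
    define t where "t = inner (x - p) y / inner y y"
    have yy: "inner y y > 0" using False by simp
    have "p + t *\<^sub>R y \<in> S" using S pS y csubspace_scaleR[OF S y] by (auto simp: csubspace_def)
    from min[OF this] have "inner (x - p) (x - p) \<le> inner (x - p - t *\<^sub>R y) (x - p - t *\<^sub>R y)"
      by (simp add: power2_norm_eq_inner diff_diff_eq)
    also have "\<dots> = inner (x - p) (x - p) - 2 * t * inner (x - p) y + t * t * inner y y"
      by (simp add: inner_simps inner_commute algebra_simps)
    also have "t * t * inner y y = t * inner (x - p) y" using yy by (simp add: t_def)
    finally have "t * inner (x - p) y \<le> 0" by linarith
    then have "(inner (x - p) y)\<^sup>2 \<le> 0" using yy
      by (simp add: t_def power2_eq_square divide_le_0_iff)
    then show ?thesis by simp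
  qed simp
  (* the imaginary part of the scalar product with y is the real one with \<i> y *)
  have "cinner (x - p) y = 0" if y: "y \<in> S" for y
  proof (rule complex_eqI)
    show "Re (cinner (x - p) y) = Re 0" using orth[OF y] by (simp add: inner_Re_cinner)
    have "inner (x - p) (\<i> *\<^sub>C y) = 0" using S y by (intro orth) (auto simp: csubspace_def)
    then show "Im (cinner (x - p) y) = Im 0"
      by (simp add: inner_Re_cinner cinner_scaleC_right)
  qed
  then show thesis using that pS by (auto simp: orthogonal_complement_def)
qed

text \<open>The functionals are antilinear because they are represented through the second argument of the
  scalar product, as \<open>a(u, \<cdot>)\<close> will be. The representing vector spans the orthogonal complement
  of the kernel.\<close>

lemma riesz_representation:
  fixes \<phi> :: "'a::complex_hilbert \<Rightarrow> complex"
  assumes add: "\<And>x y. \<phi> (x + y) = \<phi> x + \<phi> y"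
    and scale: "\<And>c x. \<phi> (c *\<^sub>C x) = cnj c * \<phi> x"
    and cont: "continuous_on UNIV \<phi>"
  obtains w where "\<And>v. \<phi> v = cinner w v"
proof (cases "\<forall>v. \<phi> v = 0")
  case True
  then show thesis using that[of 0] by (simp add: cinner_zero_left)
next
  case False
  then obtain x where x: "\<phi> x \<noteq> 0" by blast
  define K where "K = {v. \<phi> v = 0}"
  have minus: "\<phi> (y - z) = \<phi> y - \<phi> z" for y z
    using add[of y "- z"] scale[of "- 1" z] by (simp add: scaleC_minus_one)
  have "csubspace K" using add scale add[of 0 0] by (auto simp: csubspace_def K_def)
  moreover have "closed K" unfolding K_def by (intro closed_Collect_eq cont continuous_intros)
  ultimately obtain p where p: "p \<in> K" "x - p \<in> orthogonal_complement K"
    by (rule orthogonal_projection_exists)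
  define q where "q = x - p"
  have q: "\<phi> q \<noteq> 0" using x p(1) by (simp add: q_def minus K_def)
  have qq: "cinner q q \<noteq> 0" using q minus[of 0 0] by (auto simp: cinner_self_eq_0)
  show thesis
  proof
    fix v
    have "v - cnj (\<phi> v / \<phi> q) *\<^sub>C q \<in> K" using q by (simp add: K_def minus scale)
    then have "cinner q (v - cnj (\<phi> v / \<phi> q) *\<^sub>C q) = 0"
      using p(2) by (simp add: orthogonal_complement_def q_def)
    then have "cinner q v = \<phi> v / \<phi> q * cinner q q"
      by (simp add: cinner_diff_right cinner_scaleC_right)
    then show "\<phi> v = cinner ((\<phi> q / cinner q q) *\<^sub>C q) v"
      using q qq by (simp add: cinner_scaleC_left)
  qed
qed

section \<open>Solvability for compactly elliptic forms\<close>

lemma sesquilinear_diff_left: "sesquilinear b \<Longrightarrow> b (u - u') v = b u v - b u' v"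
  unfolding sesquilinear_def
  by (metis add_diff_cancel_right' diff_add_cancel)

lemma continuous_form_left: "continuous_form b \<Longrightarrow> continuous_on UNIV (\<lambda>u. b u v)"
  unfolding continuous_form_def
  by (drule continuous_on_compose2[of UNIV _ UNIV "\<lambda>u. (u, v)"])
    (auto intro: continuous_on_Pair continuous_on_id continuous_on_const)

lemma continuous_form_right: "continuous_form b \<Longrightarrow> continuous_on UNIV (b u)"
  unfolding continuous_form_def
  by (drule continuous_on_compose2[of UNIV _ UNIV "\<lambda>v. (u, v)"])
    (auto intro: continuous_on_Pair continuous_on_id continuous_on_const)

text \<open>The operator of the form is obtained from the Riesz theorem in the second variable.\<close>

lemma form_operator_exists:
  fixes b :: "'v::complex_hilbert \<Rightarrow> 'v \<Rightarrow> complex"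
  assumes "sesquilinear b" "continuous_form b"
  obtains B where "\<And>u v. b u v = cinner (B u) v"
proof -
  have "\<exists>w. \<forall>v. b u v = cinner w v" for u
    by (rule riesz_representation[of "b u"])
      (use assms continuous_form_right[OF assms(2)] in \<open>auto simp: sesquilinear_def\<close>)
  then show thesis using that by metis
qed

text \<open>The ellipticity estimate, applied to differences, shows that a bounded sequence along which
  the operator \<open>B\<close> of the form converges has a convergent subsequence: the compact term is
  Cauchy along a subsequence, and the form term is controlled by \<open>B\<close>.\<close>

lemma elliptic_convergent_subsequence:
  fixes b :: "'v::complex_hilbert \<Rightarrow> 'v \<Rightarrow> complex"
    and jt :: "'v \<Rightarrow> 'w::complex_hilbert"
  assumes ses: "sesquilinear b"
    and B: "\<And>u v. b u v = cinner (B u) v"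
    and jt: "compact_operator jt" and \<mu>: "\<mu> > 0"
    and ell: "\<And>u. \<mu> * (norm u)\<^sup>2 \<le> Re (b u u) + \<omega> * (norm (jt u))\<^sup>2"
    and u: "\<And>n. norm (u n) \<le> 1" and Bu: "Cauchy (\<lambda>n. B (u n))"
  obtains l r where "strict_mono r" "(u \<circ> r) \<longlonglongrightarrow> l"
proof -
  have "seq_compact (closure (jt ` cball 0 1))"
    using jt by (simp add: compact_operator_def compact_imp_seq_compact)
  moreover have "jt (u n) \<in> closure (jt ` cball 0 1)" for n
    by (rule subsetD[OF closure_subset]) (use u in auto)
  ultimately obtain k r where r: "strict_mono r" and k: "((\<lambda>n. jt (u n)) \<circ> r) \<longlonglongrightarrow> k"
    unfolding seq_compact_def by meson
  define w where "w = u \<circ> r"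
  have Bdiff: "B (x - y) = B x - B y" for x y
  proof -
    have "cinner (B (x - y) - (B x - B y)) v = 0" for v
      by (simp add: cinner_diff_left B[symmetric] sesquilinear_diff_left[OF ses])
    from this[of "B (x - y) - (B x - B y)"] show ?thesis by (simp add: cinner_self_eq_0)
  qed
  have jtdiff: "jt (x - y) = jt x - jt y" for x y
    using jt by (simp add: compact_operator_def bounded_clinear_def linear_diff
        bounded_linear.linear)
  have C1: "Cauchy (\<lambda>n. B (w n))"
    using Cauchy_subseq_Cauchy[OF Bu r] by (simp add: w_def o_def)
  have C2: "Cauchy (\<lambda>n. jt (w n))"
    using LIMSEQ_imp_Cauchy[OF k] by (simp add: w_def o_def)
  have est: "\<mu> * (norm (w m - w n))\<^sup>2
      \<le> 2 * norm (B (w m) - B (w n)) + \<bar>\<omega>\<bar> * (norm (jt (w m) - jt (w n)))\<^sup>2" for m n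
  proof -
    let ?d = "w m - w n"
    have "norm ?d \<le> 2"
      using norm_triangle_ineq4[of "w m" "w n"] u[of "r m"] u[of "r n"] by (simp add: w_def)
    then have "norm (B ?d) * norm ?d \<le> norm (B ?d) * 2" by (simp add: mult_left_mono)
    moreover have "Re (b ?d ?d) \<le> norm (B ?d) * norm ?d"
      using norm_cinner_le[of "B ?d" ?d] complex_Re_le_cmod[of "b ?d ?d"] by (simp add: B)
    moreover have "\<omega> * (norm (jt ?d))\<^sup>2 \<le> \<bar>\<omega>\<bar> * (norm (jt ?d))\<^sup>2" by (simp add: mult_right_mono)
    ultimately show ?thesis using ell[of ?d] by (simp add: Bdiff jtdiff)
  qed
  have "Cauchy w"
  proof (rule CauchyI)
    fix e :: real assume e: "e > 0"
    (* the form term of the estimate contributes less than 2 \<delta>, the compact term at most \<delta> *)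
    define \<delta> where "\<delta> = \<mu> * e\<^sup>2 / 4"
    define \<eta> where "\<eta> = sqrt (\<delta> / (\<bar>\<omega>\<bar> + 1))"
    have \<delta>: "\<delta> > 0" using e \<mu> by (simp add: \<delta>_def)
    have \<eta>: "\<eta> > 0" "(\<bar>\<omega>\<bar> + 1) * \<eta>\<^sup>2 = \<delta>" using \<delta> by (auto simp: \<eta>_def field_simps)
    obtain M1 where M1: "\<And>m n. m \<ge> M1 \<Longrightarrow> n \<ge> M1 \<Longrightarrow> norm (B (w m) - B (w n)) < \<delta>"
      using CauchyD[OF C1 \<delta>] by blast
    obtain M2 where M2: "\<And>m n. m \<ge> M2 \<Longrightarrow> n \<ge> M2 \<Longrightarrow> norm (jt (w m) - jt (w n)) < \<eta>"
      using CauchyD[OF C2 \<eta>(1)] by blast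
    show "\<exists>M. \<forall>m\<ge>M. \<forall>n\<ge>M. norm (w m - w n) < e"
    proof (intro exI[of _ "max M1 M2"] allI impI)
      fix m n assume mn: "m \<ge> max M1 M2" "n \<ge> max M1 M2"
      have "(norm (jt (w m) - jt (w n)))\<^sup>2 \<le> \<eta>\<^sup>2"
        using M2[of m n] mn by (intro power_mono) auto
      then have "\<bar>\<omega>\<bar> * (norm (jt (w m) - jt (w n)))\<^sup>2 \<le> (\<bar>\<omega>\<bar> + 1) * \<eta>\<^sup>2"
        by (intro mult_mono) auto
      then have "\<mu> * (norm (w m - w n))\<^sup>2 < 4 * \<delta>"
        using est[of m n] M1[of m n] mn \<eta>(2) \<delta> by auto
      then have "(norm (w m - w n))\<^sup>2 < e\<^sup>2" using \<mu> by (simp add: \<delta>_def)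
      then show "norm (w m - w n) < e" using e by (simp add: power_less_imp_less_base)
    qed
  qed
  then obtain l where "w \<longlonglongrightarrow> l" using Cauchy_convergent_iff convergent_def by blast
  then show thesis using that r by (simp add: w_def)
qed

text \<open>A normalised sequence violating the estimate would, after passing to a subsequence, converge
  to a unit vector in the kernel and in its orthogonal complement.\<close>

lemma elliptic_bounded_below:
  fixes b :: "'v::complex_hilbert \<Rightarrow> 'v \<Rightarrow> complex"
    and jt :: "'v \<Rightarrow> 'w::complex_hilbert"
  assumes ses: "sesquilinear b" and cont: "continuous_form b"
    and B: "\<And>u v. b u v = cinner (B u) v"
    and jt: "compact_operator jt" and \<mu>: "\<mu> > 0"
    and ell: "\<And>u. \<mu> * (norm u)\<^sup>2 \<le> Re (b u u) + \<omega> * (norm (jt u))\<^sup>2"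
  obtains c where "c > 0" "\<And>u. u \<in> orthogonal_complement {u. \<forall>v. b u v = 0} \<Longrightarrow>
    c * norm u \<le> norm (B u)"
proof (rule ccontr)
  note bound = that
  let ?N = "{u. \<forall>v. b u v = 0}"
  assume no: "\<not> thesis"
  have Bscale: "B (c *\<^sub>C x) = c *\<^sub>C B x" for c x
  proof -
    have "cinner (B (c *\<^sub>C x) - c *\<^sub>C B x) v = 0" for v
      using ses by (simp add: cinner_diff_left cinner_scaleC_left B[symmetric] sesquilinear_def)
    from this[of "B (c *\<^sub>C x) - c *\<^sub>C B x"] show ?thesis by (simp add: cinner_self_eq_0)
  qed
  have "\<exists>u. u \<in> orthogonal_complement ?N \<and> norm u = 1 \<and> norm (B u) < 1 / real (Suc n)" for n
  proof -
    obtain x where x: "x \<in> orthogonal_complement ?N" "norm (B x) < 1 / real (Suc n) * norm x"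
      using no bound[of "1 / real (Suc n)"] by (meson not_le of_nat_0_less_iff zero_less_Suc
          zero_less_divide_1_iff)
    have xn: "norm x > 0" using x(2) by (cases "x = 0") auto
    define u where "u = complex_of_real (1 / norm x) *\<^sub>C x"
    have "u \<in> orthogonal_complement ?N"
      using x(1) csubspace_orthogonal_complement unfolding u_def csubspace_def by blast
    moreover have "norm u = 1" using xn by (simp add: u_def norm_scaleC norm_divide)
    moreover have "norm (B u) < 1 / real (Suc n)"
      using x(2) xn by (simp add: u_def Bscale norm_scaleC norm_divide field_simps)
    ultimately show ?thesis by blast
  qed
  then obtain u where u: "\<And>n. u n \<in> orthogonal_complement ?N" "\<And>n. norm (u n) = 1"
    "\<And>n. norm (B (u n)) < 1 / real (Suc n)" by metis
  have "(\<lambda>n. norm (B (u n))) \<longlonglongrightarrow> 0"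
  proof (rule tendsto_sandwich[OF _ _ tendsto_const LIMSEQ_Suc[OF lim_1_over_n]])
    show "\<forall>\<^sub>F n in sequentially. norm (B (u n)) \<le> 1 / real (Suc n)"
      using u(3) less_imp_le by (blast intro: always_eventually)
  qed simp
  then have Bu: "(\<lambda>n. B (u n)) \<longlonglongrightarrow> 0" by (rule tendsto_norm_zero_cancel)
  obtain l r where r: "strict_mono r" "(u \<circ> r) \<longlonglongrightarrow> l"
    by (rule elliptic_convergent_subsequence[OF ses B jt \<mu> ell])
      (use u(2) LIMSEQ_imp_Cauchy[OF Bu] in auto)
  have "(\<lambda>n. norm ((u \<circ> r) n)) \<longlonglongrightarrow> norm l" by (intro tendsto_intros r)
  then have nl: "norm l = 1" using u(2) by (simp add: LIMSEQ_const_iff)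
  have "l \<in> orthogonal_complement ?N"
    using closed_sequentially[OF closed_orthogonal_complement _ r(2)] u(1) by simp
  moreover have "b l v = 0" for v
  proof (rule LIMSEQ_unique)
    show "(\<lambda>n. b ((u \<circ> r) n) v) \<longlonglongrightarrow> b l v"
      using continuous_on_tendsto_compose[OF continuous_form_left[OF cont] r(2)] by simp
    have "(\<lambda>n. cinner (B ((u \<circ> r) n)) v) \<longlonglongrightarrow> cinner 0 v"
      using LIMSEQ_subseq_LIMSEQ[OF Bu r(1)]
      by (intro tendsto_cinner tendsto_const) (simp add: o_def)
    then show "(\<lambda>n. b ((u \<circ> r) n) v) \<longlonglongrightarrow> 0" by (simp add: B cinner_zero_left)
  qed
  ultimately have "cinner l l = 0" by (auto simp: orthogonal_complement_def)
  then show False using nl by (simp add: cinner_self_eq_0)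
qed

text \<open>The operator \<open>B\<close> of the form is bounded below on the orthogonal complement of its kernel, so
  its range is closed. The part of the representing vector of \<open>\<phi>\<close> orthogonal to the range lies
  in the kernel of the adjoint, hence \<open>\<phi>\<close> annihilates it and it vanishes.\<close>

lemma elliptic_form_solvable:
  fixes b :: "'v::complex_hilbert \<Rightarrow> 'v \<Rightarrow> complex"
    and jt :: "'v \<Rightarrow> 'w::complex_hilbert"
  assumes ses: "sesquilinear b" and cont: "continuous_form b"
    and jt: "compact_operator jt" and \<mu>: "\<mu> > 0"
    and ell: "\<And>u. \<mu> * (norm u)\<^sup>2 \<le> Re (b u u) + \<omega> * (norm (jt u))\<^sup>2"
    and add: "\<And>x y. \<phi> (x + y) = \<phi> x + \<phi> y"
    and scale: "\<And>c x. \<phi> (c *\<^sub>C x) = cnj c * \<phi> x"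
    and cont_\<phi>: "continuous_on UNIV \<phi>"
    and ann: "\<And>q. (\<And>w. b w q = 0) \<Longrightarrow> \<phi> q = 0"
  obtains u where "\<And>v. b u v = \<phi> v"
proof -
  define N where "N = {u. \<forall>v. b u v = 0}"
  let ?W = "orthogonal_complement N"
  obtain B where B: "\<And>u v. b u v = cinner (B u) v"
    using form_operator_exists[OF ses cont] by blast
  obtain c where c: "c > 0" "\<And>u. u \<in> ?W \<Longrightarrow> c * norm u \<le> norm (B u)"
    using elliptic_bounded_below[OF ses cont B jt \<mu> ell] unfolding N_def by blast
  have B_eqI: "B x = y" if "\<And>v. b x v = cinner y v" for x y
  proof -
    have "cinner (B x - y) v = 0" for v
      using that by (simp add: cinner_diff_left B[symmetric])
    from this[of "B x - y"] show ?thesis by (simp add: cinner_self_eq_0)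
  qed
  have Badd: "B (x + y) = B x + B y" for x y
    using ses by (intro B_eqI) (simp add: sesquilinear_def cinner_add_left B[symmetric])
  have Bdiff: "B (x - y) = B x - B y" for x y
    by (intro B_eqI) (simp add: sesquilinear_diff_left[OF ses] cinner_diff_left B[symmetric])
  have Bscale: "B (d *\<^sub>C x) = d *\<^sub>C B x" for d x
    using ses by (intro B_eqI) (simp add: sesquilinear_def cinner_scaleC_left B[symmetric])
  have B0: "B 0 = 0" using Bdiff[of 0 0] by simp
  have W: "csubspace ?W" by (rule csubspace_orthogonal_complement)
  have R: "csubspace (B ` ?W)"
    unfolding csubspace_def
  proof (intro conjI ballI allI)
    show "0 \<in> B ` ?W" using W B0 unfolding csubspace_def by (metis image_eqI)
  next
    fix x y assume "x \<in> B ` ?W" "y \<in> B ` ?W"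
    then show "x + y \<in> B ` ?W" using W unfolding csubspace_def
      by (auto simp: Badd[symmetric])
  next
    fix d x assume "x \<in> B ` ?W"
    then show "d *\<^sub>C x \<in> B ` ?W" using W unfolding csubspace_def
      by (auto simp: Bscale[symmetric])
  qed
  have "closed (B ` ?W)"
    unfolding closed_sequential_limits
  proof (intro allI impI, elim conjE)
    fix f y assume "\<forall>n. f n \<in> B ` ?W" and f: "f \<longlonglongrightarrow> y"
    then obtain u where u: "\<And>n. u n \<in> ?W" "\<And>n. f n = B (u n)" unfolding image_iff by metis
    have "Cauchy u"
    proof (rule CauchyI)
      fix e :: real assume "e > 0"
      then have "c * e > 0" using c(1) by simp
      then obtain M where M: "\<And>m n. m \<ge> M \<Longrightarrow> n \<ge> M \<Longrightarrow> norm (f m - f n) < c * e"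
        using CauchyD[OF LIMSEQ_imp_Cauchy[OF f]] by blast
      have "norm (u m - u n) < e" if "m \<ge> M" "n \<ge> M" for m n
      proof -
        have "c * norm (u m - u n) \<le> norm (f m - f n)"
          using c(2)[OF csubspace_diff[OF W u(1)[of m] u(1)[of n]]] by (simp add: u(2) Bdiff)
        also have "\<dots> < c * e" by (rule M[OF that])
        finally show ?thesis using c(1) by simp
      qed
      then show "\<exists>M. \<forall>m\<ge>M. \<forall>n\<ge>M. norm (u m - u n) < e" by blast
    qed
    then obtain l where l: "u \<longlonglongrightarrow> l" using Cauchy_convergent_iff convergent_def by blast
    have "l \<in> ?W" using closed_sequentially[OF closed_orthogonal_complement _ l] u(1) by blast
    moreover have "B l = y"
    proof (rule B_eqI, rule LIMSEQ_unique)
      fix v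
      show "(\<lambda>n. b (u n) v) \<longlonglongrightarrow> b l v"
        using continuous_on_tendsto_compose[OF continuous_form_left[OF cont] l] by simp
      show "(\<lambda>n. b (u n) v) \<longlonglongrightarrow> cinner y v"
        unfolding B u(2)[symmetric] by (intro tendsto_cinner tendsto_const f)
    qed
    ultimately show "y \<in> B ` ?W" by blast
  qed
  obtain w where w: "\<And>v. \<phi> v = cinner w v"
    using riesz_representation[OF add scale cont_\<phi>] by blast
  obtain p where p: "p \<in> B ` ?W" "w - p \<in> orthogonal_complement (B ` ?W)"
    using orthogonal_projection_exists[OF R \<open>closed (B ` ?W)\<close>] .
  define q where "q = w - p"
  obtain u where u: "u \<in> ?W" "p = B u" using p(1) by blast
  (* q is orthogonal only to the image of the complement of N, but b vanishes on N anyway,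
     and every x splits along N *)
  have "b x q = 0" for x
  proof -
    have "csubspace N" using ses sesquilinear_diff_left[OF ses, of 0 0]
      by (auto simp: csubspace_def N_def sesquilinear_def)
    moreover have "closed N"
    proof -
      have "N = (\<Inter>v. {u. b u v = 0})" by (auto simp: N_def)
      then show ?thesis
        by (auto intro!: closed_INT closed_Collect_eq continuous_form_left[OF cont])
    qed
    ultimately obtain y where y: "y \<in> N" "x - y \<in> ?W" by (rule orthogonal_projection_exists)
    have "cinner q (B (x - y)) = 0"
      using p(2) y(2) by (simp add: orthogonal_complement_def q_def)
    then have "b (x - y) q = 0" using cinner_commute[of "B (x - y)" q] by (simp add: B)
    then show ?thesis using y(1) by (simp add: sesquilinear_diff_left[OF ses] N_def)
  qed
  then have "\<phi> q = 0" "b u q = 0" using ann by blast+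
  then have "cinner q q = 0"
    unfolding w B u(2)[symmetric] by (simp add: q_def cinner_diff_left)
  then have "w = B u" by (simp add: cinner_self_eq_0 q_def u(2))
  then show thesis using that w B by simp
qed

section \<open>Self-adjoint graphs\<close>

text \<open>For \<open>y \<in> A(0)\<close> all values \<open>(x, z + c y)\<close> are real, which forces \<open>(x, y) = 0\<close>. Conversely, if
  \<open>y \<bottom> D(A)\<close> is written as \<open>z + \<i> x\<close> with \<open>(x, z) \<in> A\<close>, then the imaginary part of \<open>(y, x) = 0\<close>
  is \<open>\<parallel>x\<parallel>\<^sup>2\<close>, so \<open>x = 0\<close>.\<close>

lemma self_adjoint_graph_image_0:
  assumes A: "self_adjoint_graph A"
  shows "A `` {0} = orthogonal_complement (Domain A)"
proof (intro set_eqI iffI)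
  fix y assume "y \<in> A `` {0}"
  then have y: "(0, y) \<in> A" by simp
  have "cinner y x = 0" if "(x, z) \<in> A" for x z
  proof -
    have c0: "c *\<^sub>C (0::'a) = 0" for c
      using cinner_self_eq_0[of "c *\<^sub>C (0::'a)"] by (simp add: cinner_scaleC_left cinner_zero_left)
    have mem: "(x, z + c *\<^sub>C y) \<in> A" for c
      using A that y c0 unfolding self_adjoint_graph_def linear_graph_def
      by (metis add.right_neutral)
    have real: "cinner x (z + c *\<^sub>C y) \<in> \<real>" for c
      using A mem unfolding self_adjoint_graph_def by blast
    moreover have "cinner x z \<in> \<real>" using A that unfolding self_adjoint_graph_def by blast
    ultimately have "Im (cnj c * cinner x y) = 0" for c
      by (simp add: complex_is_Real_iff cinner_add_right cinner_scaleC_right)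
    from this[of 1] this[of \<i>] have "cinner x y = 0" by (simp add: complex_eq_iff)
    then show ?thesis using cinner_commute[of y x] by simp
  qed
  then show "y \<in> orthogonal_complement (Domain A)" by (auto simp: orthogonal_complement_def)
next
  fix y assume y: "y \<in> orthogonal_complement (Domain A)"
  have "Range (graph_shift A (\<i> * complex_of_real 1)) = UNIV"
    using A unfolding self_adjoint_graph_def by (metis zero_neq_one)
  then have "y \<in> Range (graph_shift A \<i>)" by simp
  then obtain x z where xz: "(x, z) \<in> A" "y = z + \<i> *\<^sub>C x" by (auto simp: graph_shift_def)
  have "cinner x y = 0"
    using y xz(1) cinner_commute[of x y] by (auto simp: orthogonal_complement_def)
  moreover have "cinner x z \<in> \<real>" using A xz(1) unfolding self_adjoint_graph_def by blast
  ultimately have "(norm x)\<^sup>2 = 0"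
    by (auto simp: xz(2) cinner_add_right cinner_scaleC_right cinner_self complex_is_Real_iff
        complex_eq_iff)
  then have "x = 0" by simp
  moreover from this have "\<i> *\<^sub>C x = 0"
    using norm_scaleC[of \<i> x] by simp
  ultimately show "y \<in> A `` {0}" using xz by simp
qed

lemma self_adjoint_graph_orthogonal_image_0:
  fixes A :: "('h::complex_hilbert \<times> 'h) set"
  assumes A: "self_adjoint_graph A"
  shows "orthogonal_complement (A `` {0}) = closure (Domain A)"
proof
  have "Domain A \<subseteq> orthogonal_complement (A `` {0})"
    unfolding self_adjoint_graph_image_0[OF A] orthogonal_complement_def
    by clarsimp (metis cinner_commute complex_cnj_zero DomainI)
  then show "closure (Domain A) \<subseteq> orthogonal_complement (A `` {0})"
    using closed_orthogonal_complement closure_minimal by blast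
next
  have lin: "linear_graph A" using A by (simp add: self_adjoint_graph_def)
  have "csubspace (Domain A)" using lin unfolding linear_graph_def csubspace_def by blast
  then have cs: "csubspace (closure (Domain A))" by (rule csubspace_closure)
  show "orthogonal_complement (A `` {0}) \<subseteq> closure (Domain A)"
  proof
    fix x assume x: "x \<in> orthogonal_complement (A `` {0})"
    obtain p where p: "p \<in> closure (Domain A)"
      "x - p \<in> orthogonal_complement (closure (Domain A))"
      using orthogonal_projection_exists[OF cs closed_closure] .
    let ?q = "x - p"
    have "?q \<in> A `` {0}"
      unfolding self_adjoint_graph_image_0[OF A]
      using p(2) subsetD[OF closure_subset] unfolding orthogonal_complement_def by blast
    then have "cinner x ?q = 0" using x by (simp add: orthogonal_complement_def)
    moreover have "cinner p ?q = 0"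
      using p cinner_commute[of p ?q] by (simp add: orthogonal_complement_def)
    ultimately have "cinner ?q ?q = 0" by (simp add: cinner_diff_left)
    then show "x \<in> closure (Domain A)" using p(1) by (simp add: cinner_self_eq_0)
  qed
qed

text \<open>Existence of the value of the single-valued part comes from projecting onto \<open>A(0)\<close>, which is
  closed as an orthogonal complement; uniqueness holds because two candidates differ by an
  element of \<open>A(0)\<close>.\<close>

lemma graph_single_valued_part:
  fixes A :: "('h::complex_hilbert \<times> 'h) set"
  assumes A: "self_adjoint_graph A"
  shows "Map.graph (single_valued_part A) = A \<inter> (UNIV \<times> orthogonal_complement (A `` {0}))"
proof -
  let ?P = "orthogonal_complement (A `` {0})"
  have lin: "linear_graph A" using A by (simp add: self_adjoint_graph_def)
  have diff: "(x - x', y - y') \<in> A" if "(x, y) \<in> A" "(x', y') \<in> A" for x y x' y'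
    using lin that unfolding linear_graph_def by (metis add_uminus_conv_diff scaleC_minus_one)
  have ex: "\<exists>y. y \<in> ?P \<and> (x, y) \<in> A" if "(x, z) \<in> A" for x z
  proof -
    have "csubspace (A `` {0})" "closed (A `` {0})"
      unfolding self_adjoint_graph_image_0[OF A]
      by (rule csubspace_orthogonal_complement closed_orthogonal_complement)+
    then obtain p where "p \<in> A `` {0}" "z - p \<in> ?P" by (rule orthogonal_projection_exists)
    then show ?thesis using diff[OF that, of 0 p] by auto
  qed
  have uniq: "y = y'" if "y \<in> ?P" "(x, y) \<in> A" "y' \<in> ?P" "(x, y') \<in> A" for x y y'
  proof -
    have "y - y' \<in> A `` {0}" using diff[OF that(2,4)] by simp
    moreover have "y - y' \<in> ?P"
      using csubspace_diff[OF csubspace_orthogonal_complement that(1,3)] .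
    ultimately have "cinner (y - y') (y - y') = 0" by (simp add: orthogonal_complement_def)
    then show ?thesis by (simp add: cinner_self_eq_0)
  qed
  have "single_valued_part A x = Some y \<longleftrightarrow> (x, y) \<in> A \<and> y \<in> ?P" for x y
  proof (cases "x \<in> Domain A")
    case True
    then obtain y' where y': "y' \<in> ?P" "(x, y') \<in> A" using ex by blast
    then have "(THE y. y \<in> ?P \<and> (x, y) \<in> A) = y'" using uniq by blast
    then show ?thesis using True y' uniq by (auto simp: single_valued_part_def)
  qed (auto simp: single_valued_part_def)
  then show ?thesis by (auto simp: Map.graph_def)
qed

section \<open>The graph associated with a form\<close>

lemma linear_graph_associated_graph:
  assumes a: "sesquilinear a" and j: "bounded_clinear j"
  shows "linear_graph (associated_graph a j)"
proof -
  have j': "j (u + u') = j u + j u'" "j (c *\<^sub>C u) = c *\<^sub>C j u" for u u' c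
    using j by (auto simp: bounded_clinear_def bounded_linear.linear linear_add)
  have "j 0 = 0" using j by (simp add: bounded_clinear_def linear_0 bounded_linear.linear)
  moreover have "a 0 v = 0" for v using sesquilinear_diff_left[OF a, of 0 0 v] by simp
  ultimately have 0: "(0, 0) \<in> associated_graph a j"
    by (auto simp: associated_graph_def cinner_zero_left intro!: exI[of _ 0])
  have "(j u + j u', y + y') \<in> associated_graph a j"
    if "\<forall>v. a u v = cinner y (j v)" "\<forall>v. a u' v = cinner y' (j v)" for u u' y y'
    using a that by (auto simp: associated_graph_def j' cinner_add_left sesquilinear_def
        intro!: exI[of _ "u + u'"])
  moreover have "(c *\<^sub>C j u, c *\<^sub>C y) \<in> associated_graph a j"
    if "\<forall>v. a u v = cinner y (j v)" for c u y
    using a that by (auto simp: associated_graph_def j' cinner_scaleC_left sesquilinear_def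
        intro!: exI[of _ "c *\<^sub>C u"])
  ultimately show ?thesis using 0 unfolding linear_graph_def
    by (auto simp: associated_graph_def)
qed

text \<open>Surjectivity of \<open>A + \<i> s I\<close> at \<open>f\<close> means solving \<open>b(u, v) = (f, j v)\<close> for
  \<open>b(u, v) = a(u, v) + \<i> s (j u, j v)\<close>. The form \<open>b\<close> has the same real part on the diagonal as
  \<open>a\<close>, hence the same ellipticity estimate. If \<open>b(\<cdot>, q) = 0\<close>, then the imaginary part of
  \<open>b(q, q)\<close> gives \<open>j q = 0\<close>, so the right-hand side annihilates \<open>q\<close> and the equation is
  solvable.\<close>

lemma self_adjoint_associated_graph:
  fixes a :: "'v::complex_hilbert \<Rightarrow> 'v \<Rightarrow> complex"
    and j :: "'v \<Rightarrow> 'h::complex_hilbert"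
  assumes a: "sesquilinear a" and cont: "continuous_form a" and sym: "symmetric_form a"
    and ell: "compactly_elliptic TYPE('w::complex_hilbert) a" and j: "bounded_clinear j"
  shows "self_adjoint_graph (associated_graph a j)"
proof -
  have j': "j (u + u') = j u + j u'" "j (c *\<^sub>C u) = c *\<^sub>C j u" for u u' c
    using j by (auto simp: bounded_clinear_def bounded_linear.linear linear_add)
  have contj: "continuous_on S j" for S
    using j by (simp add: bounded_clinear_def linear_continuous_on)
  have diag: "a u u \<in> \<real>" for u
  proof -
    have "a u u = cnj (a u u)" using sym unfolding symmetric_form_def by blast
    then show ?thesis by (metis Reals_cnj_iff)
  qed
  obtain jt :: "'v \<Rightarrow> 'w" and \<omega> \<mu> where jt: "compact_operator jt" "\<mu> > 0"
    and ell': "\<And>u. \<mu> * (norm u)\<^sup>2 \<le> Re (a u u) + \<omega> * (norm (jt u))\<^sup>2"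
    using ell unfolding compactly_elliptic_def by blast
  have real: "cinner x y \<in> \<real>" if xy: "(x, y) \<in> associated_graph a j" for x y
  proof -
    obtain u where "j u = x" "\<forall>v. a u v = cinner y (j v)"
      using xy unfolding associated_graph_def by blast
    then have "cinner y x = a u u" by metis
    then have "cnj (cinner x y) \<in> \<real>" using diag cinner_commute[of y x] by metis
    then show ?thesis by (simp add: complex_is_Real_iff)
  qed
  have "f \<in> Range (graph_shift (associated_graph a j) (\<i> * complex_of_real s))"
    if s: "s \<noteq> 0" for s :: real and f :: 'h
  proof -
    define b where "b u v = a u v + \<i> * complex_of_real s * cinner (j u) (j v)" for u v
    have b: "sesquilinear b"
      using a unfolding sesquilinear_def b_def
      by (simp add: j' cinner_add_left cinner_add_right cinner_scaleC_left cinner_scaleC_right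
          algebra_simps)
    have contb: "continuous_form b"
      using cont unfolding continuous_form_def b_def case_prod_unfold
      by (intro continuous_intros continuous_on_cinner continuous_on_compose2[OF contj[of UNIV]])
        auto
    have Re_b: "Re (b u u) = Re (a u u)" for u
      by (simp add: b_def cinner_self)
    have ellb: "\<mu> * (norm u)\<^sup>2 \<le> Re (b u u) + \<omega> * (norm (jt u))\<^sup>2" for u
      using ell' by (simp add: Re_b)
    have "\<exists>u. \<forall>v. b u v = cinner f (j v)"
    proof (rule elliptic_form_solvable[OF b contb jt ellb, of "\<lambda>v. cinner f (j v)"])
      show "continuous_on UNIV (\<lambda>v. cinner f (j v))"
        by (intro continuous_on_cinner continuous_on_const contj)
    next
      fix q assume "\<And>w. b w q = 0"
      then have "Im (b q q) = 0" by simp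
      then have "s * (norm (j q))\<^sup>2 = 0"
        using diag[of q] by (simp add: b_def cinner_self complex_is_Real_iff)
      then show "cinner f (j q) = 0" using s by (simp add: cinner_zero_right)
    qed (auto simp: j' cinner_add_right cinner_scaleC_right)
    then obtain u where u: "\<And>v. b u v = cinner f (j v)" by blast
    define y where "y = f - (\<i> * complex_of_real s) *\<^sub>C j u"
    have "a u v = cinner y (j v)" for v
      using u[of v] by (simp add: y_def b_def cinner_diff_left cinner_scaleC_left algebra_simps)
    then have "(j u, y) \<in> associated_graph a j" by (auto simp: associated_graph_def)
    then show ?thesis unfolding graph_shift_def y_def by force
  qed
  then show ?thesis
    unfolding self_adjoint_graph_def
    using linear_graph_associated_graph[OF a j] real by auto
qed

lemma Domain_associated_graph_subset: "Domain (associated_graph a j) \<subseteq> j ` form_subspace a j"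
  by (auto simp: associated_graph_def form_subspace_def cinner_zero_right)

text \<open>If \<open>(0, y) \<in> A\<close> is witnessed by \<open>u \<in> ker j\<close>, then \<open>(y, j w) = a(u, w)\<close>, which vanishes for
  \<open>w \<in> V(a)\<close> by symmetry of the form.\<close>

lemma form_subspace_image_orthogonal:
  assumes "symmetric_form a"
  shows "j ` form_subspace a j \<subseteq> orthogonal_complement (associated_graph a j `` {0})"
proof -
  have "cinner (j w) y = 0"
    if "w \<in> form_subspace a j" "j u = 0" "\<forall>v. a u v = cinner y (j v)" for w u y
  proof -
    have "a w u = 0" using that by (simp add: form_subspace_def)
    then have "a u w = 0" using assms unfolding symmetric_form_def by (metis complex_cnj_zero)
    then have "cinner y (j w) = 0" using that(3) by simp
    then show ?thesis using cinner_commute[of "j w" y] by simp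
  qed
  then show ?thesis by (auto simp: orthogonal_complement_def associated_graph_def)
qed

theorem proposition4p15:
  fixes a :: "'v::complex_hilbert \<Rightarrow> 'v \<Rightarrow> complex"
    and j :: "'v \<Rightarrow> 'h::complex_hilbert"
  assumes "sesquilinear a"
    and "continuous_form a"
    and "symmetric_form a"
    and "compactly_elliptic TYPE('w::complex_hilbert) a"
    and "bounded_clinear j"
  shows "let A = associated_graph a j;
             H\<^sub>1 = closure (j ` form_subspace a j)
         in self_adjoint_graph A \<and>
            A \<inter> (H\<^sub>1 \<times> H\<^sub>1) = Map.graph (single_valued_part A)"
proof -
  define A where "A = associated_graph a j"
  define H1 where "H1 = closure (j ` form_subspace a j)"
  have sa: "self_adjoint_graph A"
    unfolding A_def by (rule self_adjoint_associated_graph[OF assms])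
  have orth: "orthogonal_complement (A `` {0}) = closure (Domain A)"
    by (rule self_adjoint_graph_orthogonal_image_0[OF sa])
  have dom: "Domain A \<subseteq> H1"
    using Domain_associated_graph_subset closure_subset unfolding A_def H1_def by blast
  have "H1 = closure (Domain A)"
  proof
    show "H1 \<subseteq> closure (Domain A)"
      using form_subspace_image_orthogonal[OF assms(3), of j] orth
      unfolding H1_def A_def by (intro closure_minimal) auto
    show "closure (Domain A) \<subseteq> H1"
      using dom unfolding H1_def by (intro closure_minimal) auto
  qed
  then have "A \<inter> (H1 \<times> H1) = Map.graph (single_valued_part A)"
    using dom unfolding graph_single_valued_part[OF sa] orth by blast
  then show ?thesis using sa unfolding A_def H1_def Let_def by blast
qed

end
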